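(* Let $\Omega_i=\mathbb{R}^{m_i}$, $i=1,2,3$. Suppose that $W^{2d}$ is convex and locally strictly convex at the point $(u^{1d},u^{2d},u^{3d})$, that Assumption (A) of the context is satisfied, and that $J_2$ is Fréchet differentiable at $(u^{1d},u^{2d},u^{3d})$. If $\nabla_{u^1}J_2(u^{1d},u^{2d},u^{3d})\neq 0$, then there exists an affine map $\gamma^1:\Omega_2\times\Omega_3\to\Omega_1$ (of the leader) that realizes the desired equilibrium $(u^{1d},u^{2d},u^{3d})$.
   Context: Trilevel static game: the leader, the middle level player and the follower choose $u^1\in\Omega_1$, $u^2\in\Omega_2$, $u^3\in\Omega_3$ respectively, where $\Omega_i=\mathbb{R}^{m_i}$, $m_i\ge 1$, and minimize cost functions $J_1,J_2,J_3:\Omega_1\times\Omega_2\times\Omega_3\to\mathbb{R}$ respectively. $J_1$ is assumed to have a unique global minimizer $(u^{1d},u^{2d},u^{3d})$, called the desired equilibrium. Sublevel set: $W^{2d}=\{(u^1,u^2,u^3): J_2(u^1,u^2,u^3)\le J_2(u^{1d},u^{2d},u^{3d})\}$. Strategy classes: $\Gamma^1$ is the set of affine maps $\gamma^1:\Omega_2\times\Omega_3\to\Omega_1$ with $\gamma^1(u^{2d},u^{3d})=u^{1d}$; $\Gamma^2$ is the set of affine maps $\gamma^2:\Omega_3\to\Omega_2$ with $\gamma^2(u^{3d})=u^{2d}$. Condition (L) on $\gamma^1\in\Gamma^1$: $(u^{2d},u^{3d})$ is the unique minimizer of $(u^2,u^3)\mapsto J_2(\gamma^1(u^2,u^3),u^2,u^3)$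 over $\Omega_2\times\Omega_3$. Condition (M) on a pair $\gamma^1\in\Gamma^1,\gamma^2\in\Gamma^2$: $u^{3d}$ is the unique minimizer of $u^3\mapsto J_3(\gamma^1(\gamma^2(u^3),u^3),\gamma^2(u^3),u^3)$ over $\Omega_3$. The map $\gamma^1$ realizes the desired equilibrium if $\gamma^1\in\Gamma^1$, (L) holds, and there is $\gamma^2\in\Gamma^2$ such that (M) holds. Assumption (A): for every $\gamma^1\in\Gamma^1$ satisfying (L) there is $\gamma^2\in\Gamma^2$ such that (M) holds. A set $W$ is locally strictly convex at a point $x\in W$ if $x$ is a boundary point of $W$ and there is a neighbourhood $U$ of $x$ such that for every $y\in W\cap U$, $y\ne x$, the open segment between $x$ and $y$ lies in the interior of $W$. *)

theory Defs
  imports "HOL-Analysis.Analysis"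
begin

definition affine_map :: "('a::real_vector \<Rightarrow> 'b::real_vector) \<Rightarrow> bool" where
  "affine_map f \<longleftrightarrow> (\<exists>L c. linear L \<and> f = (\<lambda>x. L x + c))"

definition unique_minimizer :: "('a \<Rightarrow> real) \<Rightarrow> 'a \<Rightarrow> bool" where
  "unique_minimizer f x \<longleftrightarrow>
     is_arg_min f (\<lambda>_. True) x \<and> (\<forall>y. is_arg_min f (\<lambda>_. True) y \<longrightarrow> y = x)"

definition locally_strictly_convex_at :: "'a::real_normed_vector set \<Rightarrow> 'a \<Rightarrow> bool" where
  "locally_strictly_convex_at W x \<longleftrightarrow>
     x \<in> W \<and> x \<in> frontier W \<and>
     (\<exists>U. open U \<and> x \<in> U \<and> (\<forall>y\<in>W \<inter> U. y \<noteq> x \<longrightarrow> open_segment x y \<subseteq> interior W))"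

text \<open>Only meaningful where \<open>f\<close> is differentiable; there \<open>gradient_eqI\<close> below determines its value.\<close>

definition gradient :: "('a::real_inner \<Rightarrow> real) \<Rightarrow> 'a \<Rightarrow> 'a" where
  "gradient f x = (THE g. GDERIV f x :> g)"

lemma gradient_eqI:
  assumes "GDERIV f x :> g"
  shows "gradient f x = g"
  unfolding gradient_def
proof (rule the_equality)
  show "GDERIV f x :> g" by (fact assms)
next
  fix h assume "GDERIV f x :> h"
  with assms have "(\<lambda>v. inner v h) = (\<lambda>v. inner v g)"
    unfolding gderiv_def by (rule has_derivative_unique[rotated])
  then show "h = g"
    by (metis vector_eq_rdot inner_commute)
qed

definition grad1 :: "('a::real_inner \<times> 'b \<Rightarrow> real) \<Rightarrow> 'a \<times> 'b \<Rightarrow> 'a" where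
  "grad1 J u = gradient (\<lambda>x. J (x, snd u)) (fst u)"

definition sublevel :: "('a \<Rightarrow> real) \<Rightarrow> 'a \<Rightarrow> 'a set" where
  "sublevel J d = {u. J u \<le> J d}"

definition Gamma1 ::
  "'a::real_vector \<times> 'b::real_vector \<times> 'c::real_vector \<Rightarrow> ('b \<times> 'c \<Rightarrow> 'a) set" where
  "Gamma1 = (\<lambda>(u1d, u2d, u3d). {\<gamma>1. affine_map \<gamma>1 \<and> \<gamma>1 (u2d, u3d) = u1d})"

definition Gamma2 ::
  "'a \<times> 'b::real_vector \<times> 'c::real_vector \<Rightarrow> ('c \<Rightarrow> 'b) set" where
  "Gamma2 = (\<lambda>(u1d, u2d, u3d). {\<gamma>2. affine_map \<gamma>2 \<and> \<gamma>2 u3d = u2d})"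

definition condition_L ::
  "('a \<times> 'b \<times> 'c \<Rightarrow> real) \<Rightarrow> 'a \<times> 'b \<times> 'c \<Rightarrow> ('b \<times> 'c \<Rightarrow> 'a) \<Rightarrow> bool" where
  "condition_L J2 = (\<lambda>(u1d, u2d, u3d) \<gamma>1.
     unique_minimizer (\<lambda>(u2, u3). J2 (\<gamma>1 (u2, u3), u2, u3)) (u2d, u3d))"

definition condition_M ::
  "('a \<times> 'b \<times> 'c \<Rightarrow> real) \<Rightarrow> 'a \<times> 'b \<times> 'c \<Rightarrow> ('b \<times> 'c \<Rightarrow> 'a) \<Rightarrow> ('c \<Rightarrow> 'b) \<Rightarrow> bool" where
  "condition_M J3 = (\<lambda>(u1d, u2d, u3d) \<gamma>1 \<gamma>2.
     unique_minimizer (\<lambda>u3. J3 (\<gamma>1 (\<gamma>2 u3, u3), \<gamma>2 u3, u3)) u3d)"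

definition realizes ::
  "('a::real_vector \<times> 'b::real_vector \<times> 'c::real_vector \<Rightarrow> real) \<Rightarrow> ('a \<times> 'b \<times> 'c \<Rightarrow> real)
     \<Rightarrow> 'a \<times> 'b \<times> 'c \<Rightarrow> ('b \<times> 'c \<Rightarrow> 'a) \<Rightarrow> bool" where
  "realizes J2 J3 d \<gamma>1 \<longleftrightarrow>
     \<gamma>1 \<in> Gamma1 d \<and> condition_L J2 d \<gamma>1 \<and> (\<exists>\<gamma>2\<in>Gamma2 d. condition_M J3 d \<gamma>1 \<gamma>2)"

definition assumption_A ::
  "('a::real_vector \<times> 'b::real_vector \<times> 'c::real_vector \<Rightarrow> real) \<Rightarrow> ('a \<times> 'b \<times> 'c \<Rightarrow> real)
     \<Rightarrow> 'a \<times> 'b \<times> 'c \<Rightarrow> bool" where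
  "assumption_A J2 J3 d \<longleftrightarrow>
     (\<forall>\<gamma>1\<in>Gamma1 d. condition_L J2 d \<gamma>1 \<longrightarrow> (\<exists>\<gamma>2\<in>Gamma2 d. condition_M J3 d \<gamma>1 \<gamma>2))"

end

theory Submission
  imports Defs
begin

text \<open>
  Convexity of the sublevel set puts it on one side of the tangent hyperplane at the desired
  equilibrium, and local strict convexity leaves no other point of contact. As the derivative
  of \<open>J2\<close> does not vanish in the direction of \<open>u1\<close>, the graph of an affine map of \<open>(u2, u3)\<close> fits
  inside this hyperplane; off the equilibrium \<open>J2\<close> is larger on this graph.
\<close>

text \<open>If \<open>D (y - d)\<close> were positive, \<open>f\<close> would rise strictly above
  \<open>f d\<close> just after leaving \<open>d\<close> towards \<open>y\<close>, while convexity
  keeps the whole segment from \<open>d\<close> to \<open>y\<close> in the sublevel set.\<close>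

lemma has_derivative_nonpos_on_convex_sublevel:
  fixes f :: "'a::real_normed_vector \<Rightarrow> real"
  assumes D: "(f has_derivative D) (at d)"
    and conv: "convex (sublevel f d)"
    and y: "y \<in> sublevel f d"
  shows "D (y - d) \<le> 0"
proof (rule ccontr)
  assume pos: "\<not> D (y - d) \<le> 0"
  have "((\<lambda>t. f (d + t *\<^sub>R (y - d))) has_derivative (\<lambda>t. D (t *\<^sub>R (y - d)))) (at 0)"
    by (rule has_derivative_compose[where f = "\<lambda>t. d + t *\<^sub>R (y - d)" and g = f])
      (auto intro!: derivative_eq_intros D)
  moreover have "D (t *\<^sub>R (y - d)) = D (y - d) * t" for t
    using linear_scale[OF has_derivative_linear[OF D]] by simp
  ultimately have "((\<lambda>t. f (d + t *\<^sub>R (y - d))) has_real_derivative D (y - d)) (at 0)"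
    by (simp add: has_field_derivative_def)
  from DERIV_pos_inc_right[OF this] pos obtain e where "e > 0"
    and inc: "\<And>h. 0 < h \<Longrightarrow> h < e \<Longrightarrow> f d < f (d + h *\<^sub>R (y - d))"
    by auto
  \<comment> \<open>The bound \<open>e / 2\<close> keeps \<open>h\<close> where \<open>f\<close> has
    increased; the bound 1 keeps the point a convex combination of \<open>d\<close> and
    \<open>y\<close>.\<close>
  define h where "h = min 1 (e / 2)"
  have h: "0 < h" "h < e" "h \<le> 1"
    using \<open>e > 0\<close> by (auto simp: h_def)
  have "(1 - h) *\<^sub>R d + h *\<^sub>R y \<in> sublevel f d"
    using conv y h by (intro convexD) (auto simp: sublevel_def)
  moreover have "(1 - h) *\<^sub>R d + h *\<^sub>R y = d + h *\<^sub>R (y - d)"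
    by (simp add: algebra_simps)
  ultimately show False
    using inc[OF h(1,2)] by (simp add: sublevel_def)
qed

text \<open>A second contact point \<open>y\<close> would yield an interior point of the sublevel
  set on the hyperplane. Pushing it slightly along \<open>e\<close> or \<open>-e\<close>, whichever
  increases \<open>D\<close>, stays in the set but crosses to the side excluded by the previous
  lemma.\<close>

lemma greater_on_tangent_hyperplane:
  fixes f :: "'a::real_normed_vector \<Rightarrow> real"
  assumes D: "(f has_derivative D) (at d)"
    and nz: "D e \<noteq> 0"
    and conv: "convex (sublevel f d)"
    and lsc: "locally_strictly_convex_at (sublevel f d) d"
    and tangent: "D (y - d) = 0"
    and "y \<noteq> d"
  shows "f d < f y"
proof (rule ccontr)
  assume "\<not> f d < f y"
  then have y: "y \<in> sublevel f d"
    by (simp add: sublevel_def)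
  have lin: "linear D"
    using D by (rule has_derivative_linear)
  obtain U where U: "open U" "d \<in> U"
    and seg: "\<And>z. z \<in> sublevel f d \<inter> U \<Longrightarrow> z \<noteq> d \<Longrightarrow> open_segment d z \<subseteq> interior (sublevel f d)"
    using lsc unfolding locally_strictly_convex_at_def by blast
  obtain r where "r > 0" and r: "ball d r \<subseteq> U"
    using U openE by blast
  \<comment> \<open>Local strict convexity speaks only about points of \<open>U\<close>, so
    \<open>y\<close> is replaced by a point \<open>z\<close> of the segment from \<open>d\<close> to
    \<open>y\<close> at distance at most \<open>r / 2\<close> from \<open>d\<close>.\<close>
  define h where "h = min 1 (r / (2 * norm (y - d)))"
  have h: "0 < h" "h \<le> 1"
    using \<open>r > 0\<close> \<open>y \<noteq> d\<close> by (auto simp: h_def)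
  define z where "z = d + h *\<^sub>R (y - d)"
  have "h * norm (y - d) \<le> r / 2"
    using \<open>y \<noteq> d\<close> mult_right_mono[of h "r / (2 * norm (y - d))" "norm (y - d)"]
    by (simp add: h_def)
  then have "z \<in> U"
    using r \<open>r > 0\<close> h by (auto simp: z_def dist_norm intro!: subsetD[OF r])
  moreover have "z \<in> sublevel f d"
  proof -
    have "(1 - h) *\<^sub>R d + h *\<^sub>R y \<in> sublevel f d"
      using conv y h by (intro convexD) (auto simp: sublevel_def)
    then show ?thesis
      by (simp add: z_def algebra_simps)
  qed
  moreover have "z \<noteq> d"
    using h \<open>y \<noteq> d\<close> by (simp add: z_def)
  ultimately have "midpoint d z \<in> interior (sublevel f d)"
    using seg[of z] midpoint_in_open_segment[of d z] by auto
  then obtain s where "s > 0" and s: "ball (midpoint d z) s \<subseteq> sublevel f d"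
    by (auto simp: mem_interior)
  have "e \<noteq> 0"
    using nz linear_0[OF lin] by auto
  \<comment> \<open>The sign makes \<open>c * D e\<close> positive; the shift
    \<open>c *\<^sub>R e\<close> has norm \<open>s / 2\<close>, so it does not leave the ball of
    radius \<open>s\<close>.\<close>
  define c where "c = sgn (D e) * (s / (2 * norm e))"
  have "norm (c *\<^sub>R e) < s"
    using \<open>s > 0\<close> \<open>e \<noteq> 0\<close> nz by (simp add: c_def abs_mult abs_sgn_eq)
  then have "midpoint d z + c *\<^sub>R e \<in> sublevel f d"
    using s by (auto simp: dist_norm)
  from has_derivative_nonpos_on_convex_sublevel[OF D conv this]
  have "D (midpoint d z + c *\<^sub>R e - d) \<le> 0" .
  moreover
  have shift: "midpoint d z + c *\<^sub>R e - d = (h / 2) *\<^sub>R (y - d) + c *\<^sub>R e"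
  proof -
    have "midpoint d z - d = (1 / 2) *\<^sub>R (z - d)"
      by (simp add: midpoint_def scaleR_2[symmetric] algebra_simps flip: scaleR_add_left)
    then show ?thesis
      by (simp add: z_def algebra_simps)
  qed
  have "D (midpoint d z + c *\<^sub>R e - d) = c * D e"
    unfolding shift using lin tangent by (simp add: linear_add linear_scale)
  moreover have "c * D e = \<bar>D e\<bar> * (s / (2 * norm e))"
    by (simp add: c_def abs_sgn mult_ac)
  moreover have "\<dots> > 0"
    using nz \<open>s > 0\<close> \<open>e \<noteq> 0\<close> by simp
  ultimately show False
    by linarith
qed

text \<open>The partial derivative in the first argument is \<open>D (v, 0)\<close> as a function of
  \<open>v\<close>. If it vanished identically, the partial gradient would be 0; so some
  \<open>v\<close> has a nonzero value, and rescaling makes it 1.\<close>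

lemma grad1_nonzero_direction:
  assumes D: "(J has_derivative D) (at (a, b))"
    and nz: "grad1 J (a, b) \<noteq> 0"
  obtains e where "D (e, 0) = 1"
proof -
  have "((\<lambda>x. J (x, b)) has_derivative (\<lambda>v. D (v, 0))) (at a)"
    by (rule has_derivative_compose[where f = "\<lambda>x. (x, b)" and g = J])
      (auto intro!: derivative_eq_intros D)
  then have "GDERIV (\<lambda>x. J (x, b)) a :> 0" if "\<And>v. D (v, 0) = 0"
    using that by (simp add: gderiv_def)
  then obtain v where v: "D (v, 0) \<noteq> 0"
    using nz gradient_eqI unfolding grad1_def by fastforce
  have "D ((1 / D (v, 0)) *\<^sub>R (v, 0)) = 1"
    using linear_scale[OF has_derivative_linear[OF D], of "1 / D (v, 0)" "(v, 0)"] v by simp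
  then show thesis
    using that[of "(1 / D (v, 0)) *\<^sub>R v"] by simp
qed

lemma unique_minimizerI:
  assumes "\<And>y. y \<noteq> x \<Longrightarrow> f x < f y"
  shows "unique_minimizer f x"
  unfolding unique_minimizer_def is_arg_min_def
  using assms by (metis less_asym less_irrefl)

theorem theorem3p5:
  fixes J1 J2 J3 :: "(real ^ 'm1) \<times> (real ^ 'm2) \<times> (real ^ 'm3) \<Rightarrow> real"
    and u1d :: "real ^ 'm1" and u2d :: "real ^ 'm2" and u3d :: "real ^ 'm3"
  assumes "unique_minimizer J1 (u1d, u2d, u3d)"
    and "convex (sublevel J2 (u1d, u2d, u3d))"
    and "locally_strictly_convex_at (sublevel J2 (u1d, u2d, u3d)) (u1d, u2d, u3d)"
    and "assumption_A J2 J3 (u1d, u2d, u3d)"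
    and "J2 differentiable (at (u1d, u2d, u3d))"
    and "grad1 J2 (u1d, u2d, u3d) \<noteq> 0"
  shows "\<exists>\<gamma>1 :: (real ^ 'm2) \<times> (real ^ 'm3) \<Rightarrow> real ^ 'm1.
           realizes J2 J3 (u1d, u2d, u3d) \<gamma>1"
proof -
  obtain D where D: "(J2 has_derivative D) (at (u1d, u2d, u3d))"
    using assms(5) unfolding differentiable_def by blast
  have lin: "linear D"
    using D by (rule has_derivative_linear)
  obtain e where e: "D (e, 0) = 1"
    using grad1_nonzero_direction[OF D assms(6)] .
  \<comment> \<open>Solves \<open>D (L w, w) = 0\<close> within the line spanned by
    \<open>e\<close>: since \<open>D (e, 0) = 1\<close>, the coefficient must be
    \<open>- D (0, w)\<close>.\<close>
  define L where "L = (\<lambda>w. - D (0, w) *\<^sub>R e)"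
  have "linear L"
  proof (rule linearI)
    show "L (v + w) = L v + L w" for v w
      using linear_add[OF lin, of "(0, v)" "(0, w)"] by (simp add: L_def algebra_simps)
    show "L (c *\<^sub>R w) = c *\<^sub>R L w" for c w
      using linear_scale[OF lin, of c "(0, w)"] by (simp add: L_def)
  qed
  \<comment> \<open>The constant term moves the graph of \<open>L\<close>, which lies in the kernel
    of \<open>D\<close>, so that it passes through the desired equilibrium.\<close>
  define \<gamma> where "\<gamma> = (\<lambda>w. L w + (u1d - L (u2d, u3d)))"
  have \<gamma>_diff: "\<gamma> w - u1d = L (w - (u2d, u3d))" for w
    using linear_diff[OF \<open>linear L\<close>, of w "(u2d, u3d)"] by (simp add: \<gamma>_def)
  have \<gamma>_d: "\<gamma> (u2d, u3d) = u1d"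
    by (simp add: \<gamma>_def)
  have "affine_map \<gamma>"
    using \<open>linear L\<close> unfolding affine_map_def \<gamma>_def by blast
  then have \<gamma>: "\<gamma> \<in> Gamma1 (u1d, u2d, u3d)"
    by (simp add: Gamma1_def \<gamma>_d)
  have graph: "D (L w, w) = 0" for w
  proof -
    have "D (L w, w) = D ((- D (0, w)) *\<^sub>R (e, 0) + (0, w))"
      by (simp add: L_def)
    also have "\<dots> = 0"
      using e by (simp only: linear_add[OF lin] linear_scale[OF lin]) simp
    finally show ?thesis .
  qed
  have "J2 (u1d, u2d, u3d) < J2 (\<gamma> w, w)" if "w \<noteq> (u2d, u3d)" for w
  proof (rule greater_on_tangent_hyperplane[OF D _ assms(2,3)])
    show "D (e, 0) \<noteq> 0"
      by (simp add: e)
    have "(\<gamma> w, w) - (u1d, u2d, u3d) = (L (w - (u2d, u3d)), w - (u2d, u3d))"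
      by (simp only: diff_Pair \<gamma>_diff)
    then show "D ((\<gamma> w, w) - (u1d, u2d, u3d)) = 0"
      by (simp only: graph)
    show "(\<gamma> w, w) \<noteq> (u1d, u2d, u3d)"
      using that by auto
  qed
  then have "condition_L J2 (u1d, u2d, u3d) \<gamma>"
    unfolding condition_L_def by (fastforce intro!: unique_minimizerI simp: \<gamma>_d)
  \<comment> \<open>Condition (L) now holds for this map, so Assumption (A) supplies the middle
    player's strategy.\<close>
  with \<gamma> show ?thesis
    using assms(4) unfolding assumption_A_def realizes_def by blast
qed

end
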